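(* Assume that $F(m)m$ is convex on $[a,b]$ and that at least one information structure is implementable. Then there exists a $1$-separating information structure that maximizes the platform's revenue, i.e., an implementable information structure $I^*$ with exactly one element such that $\pi^P(I^* )\ge\pi^P(I)$ for every implementable information structure $I$.
   Context: Sellers and information. Sellers' quality levels lie in $X=[0,\overline{x}]$, $\overline{x}>0$, distributed according to a Borel probability measure $\phi$ on $X$. The platform's information is a finite measurable partition $I_o=\{A_1,\ldots,A_l\}$ of $X$ with $\phi(A_i)>0$. An information structure is a nonempty family $I=\{B_1,\ldots,B_n\}$ of pairwise disjoint nonempty sets, each a union of elements of $I_o$; it is $k$-separating if it has exactly $k$ elements. Sellers have a positive marginal cost $c(x)$, constant on each $A_i$ with value $c(A_i)$, and $c(A_i)<c(A_j)$ for $i<j$. Buyers. Types $m$ are distributed according to a continuous cumulative distribution function $F$ supported on $[a,b]\subseteq[0,\infty)$, $a<b$ ($F$ strictly increasing on $[a,b]$). With beliefs $\lambda_{B_i}$ about quality in $B_i$ (mean $\mathbb{E}_{\lambda_{B_i}}(X)$) and $p(B_i)$ the lowest price in $B_i$, a type $m$ buyer's utility from buying in $B_i$ is $Z(m,B_i,p(B_i))=m\,\mathbb{E}_{\lambda_{B_i}}(X)-p(B_i)$, and $0$ from not buying. With $\boldsymbol{p}=(p(B_1),\ldots,p(B_n))$, the demand for $B_i$ is $D_I(B_i,\boldsymbol{p})=\int_a^b1\{Z(m,B_i,p(B_i))\ge0\}1\{Z(m,B_i,p(B_i))=\max_{B\in I}Z(m,B,p(B))\}F(dm)$. Sellers'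 game. Let $H(B_i)\subseteq B_i$ be the set of participating sellers and $M_I(B_i,\boldsymbol{p})$ the mass of sellers in $B_i$ charging $p(B_i)$. If the other sellers in $H(B_i)$ charge $p(B_i)$, a participating seller $x\in B_i$ charging $p_x\ge0$ sells quantity $h_I(B_i,H(B_i),p_x,\boldsymbol{p})$ equal to $\infty$ if $p_x<p(B_i)$ and $D_I(B_i,\boldsymbol{p})>0$; $D_I(B_i,\boldsymbol{p})/M_I(B_i,\boldsymbol{p})$ if $p_x=p(B_i)$ and $D_I(B_i,\boldsymbol{p})>0$ (interpreted as $\infty$ if $M_I(B_i,\boldsymbol p)=0$); and $0$ if $p_x>p(B_i)$ or $D_I(B_i,\boldsymbol{p})=0$. The seller's utility is $\overline{U}(x,H(B_i),p_x,\boldsymbol{p})=h_I(B_i,H(B_i),p_x,\boldsymbol{p})(p_x-c(x))$ (with $\infty\cdot0=0$); not participating gives $0$. Equilibrium. For $I$, a (symmetric) equilibrium consists of positive prices $\boldsymbol{p}$ (all participating sellers in $B_i$ charge $p(B_i)$), positive masses $M_I(B_i,\boldsymbol{p})=\phi(H(B_i))$, positive demands $D_I(B_i,\boldsymbol{p})$, and beliefs $\lambda_{B_i}$ such that: (1) $p(B_i)$ is a maximizer of $p_x\mapsto\overline{U}(x,H(B_i),p_x,\boldsymbol{p})$ over $p_x\ge0$ for each $x\in H(B_i)$, and $x\in B_i$ belongs to $H(B_i)$ if and only if $\overline{U}(x,H(B_i),p(B_i),\boldsymbol{p})\ge0$; (2) buyers' decisions are optimal, as reflected in $D_I$; (3)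 $\lambda_{B_i}(A)=\phi(A\cap H(B_i))/\phi(H(B_i))$ for every measurable $A$; (4) $M_I(B_i,\boldsymbol{p})\,h_I(B_i,H(B_i),p(B_i),\boldsymbol{p})=D_I(B_i,\boldsymbol{p})$ for all $B_i\in I$. $I$ is implementable if an equilibrium under $I$ exists (the equilibrium prices, beliefs and demands are then unique). The platform's revenue from an implementable $I$ is $\pi^P(I)=\sum_{B_i\in I}p(B_i)\min\{D_I(B_i,\boldsymbol{p}),\,M_I(B_i,\boldsymbol{p})h_I(B_i,H(B_i),p(B_i),\boldsymbol{p})\}$ evaluated at equilibrium. *)

theory Defs
  imports "HOL-Probability.Probability"
begin

locale market =
  fixes xbar :: real
    and \<phi> :: "real measure"
    and A :: "nat \<Rightarrow> real set"
    and l :: nat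
    and c :: "real \<Rightarrow> real"
    and F :: "real \<Rightarrow> real"
    and a b :: real
  assumes xbar_pos: "xbar > 0"
    and sets_phi: "sets \<phi> = sets (restrict_space borel {0..xbar})"
    and prob_phi: "prob_space \<phi>"
    and cells_measurable: "\<And>i. i \<in> {1..l} \<Longrightarrow> A i \<in> sets \<phi>"
    and cells_pos: "\<And>i. i \<in> {1..l} \<Longrightarrow> measure \<phi> (A i) > 0"
    and cells_disjoint: "disjoint_family_on A {1..l}"
    and cells_cover: "(\<Union>i\<in>{1..l}. A i) = {0..xbar}"
    and cost_pos: "\<And>x. x \<in> {0..xbar} \<Longrightarrow> c x > 0"
    and cost_const: "\<And>i x y. i \<in> {1..l} \<Longrightarrow> x \<in> A i \<Longrightarrow> y \<in> A i \<Longrightarrow> c x = c y"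
    and cost_less: "\<And>i j x y. i \<in> {1..l} \<Longrightarrow> j \<in> {1..l} \<Longrightarrow> i < j \<Longrightarrow>
                      x \<in> A i \<Longrightarrow> y \<in> A j \<Longrightarrow> c x < c y"
    and a_nonneg: "0 \<le> a"
    and a_less_b: "a < b"
    and F_continuous: "continuous_on UNIV F"
    and F_strict_mono: "strict_mono_on {a..b} F"
    and F_below: "\<And>m. m \<le> a \<Longrightarrow> F m = 0"
    and F_above: "\<And>m. m \<ge> b \<Longrightarrow> F m = 1"
begin

definition info_structure :: "real set set \<Rightarrow> bool" where
  "info_structure I \<longleftrightarrow>
     I \<noteq> {} \<and> disjoint I \<and> (\<forall>B\<in>I. B \<noteq> {} \<and> (\<exists>S\<subseteq>{1..l}. B = (\<Union>i\<in>S. A i)))"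

definition separating :: "nat \<Rightarrow> real set set \<Rightarrow> bool" where
  "separating k I \<longleftrightarrow> info_structure I \<and> card I = k"

text \<open>
  Prices \<open>p\<close>, participation sets \<open>H\<close> and beliefs \<open>\<beta>\<close> are indexed by the
  sets \<open>B\<close> themselves; only their values at the members of the information structure matter.
\<close>

definition buyer_utility :: "(real set \<Rightarrow> real measure) \<Rightarrow> real \<Rightarrow> real set \<Rightarrow> real \<Rightarrow> real" where
  "buyer_utility \<beta> m B q = m * (\<integral>x. x \<partial>(\<beta> B)) - q"

definition demand ::
  "real set set \<Rightarrow> (real set \<Rightarrow> real measure) \<Rightarrow> real set \<Rightarrow> (real set \<Rightarrow> real) \<Rightarrow> real" where
  "demand I \<beta> B p =
     (LINT m:{a..b}|interval_measure F.
        of_bool (buyer_utility \<beta> m B (p B) \<ge> 0) *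
        of_bool (buyer_utility \<beta> m B (p B) = Max ((\<lambda>B'. buyer_utility \<beta> m B' (p B')) ` I)))"

text \<open>
  All sellers in \<open>H B\<close> charge \<open>p B\<close>, so the mass of sellers in \<open>B\<close> charging \<open>p B\<close>
  is the \<open>\<phi>\<close>-measure of \<open>H B\<close>.
\<close>

definition seller_mass :: "(real set \<Rightarrow> real set) \<Rightarrow> real set \<Rightarrow> real" where
  "seller_mass H B = measure \<phi> (H B)"

definition sales ::
  "real set set \<Rightarrow> (real set \<Rightarrow> real measure) \<Rightarrow> (real set \<Rightarrow> real set) \<Rightarrow>
     real set \<Rightarrow> real \<Rightarrow> (real set \<Rightarrow> real) \<Rightarrow> ereal" where
  "sales I \<beta> H B q p =
     (if q > p B \<or> demand I \<beta> B p = 0 then 0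
      else if q < p B then \<infinity>
      else if seller_mass H B = 0 then \<infinity>
      else ereal (demand I \<beta> B p / seller_mass H B))"

definition seller_utility ::
  "real set set \<Rightarrow> (real set \<Rightarrow> real measure) \<Rightarrow> (real set \<Rightarrow> real set) \<Rightarrow>
     real set \<Rightarrow> real \<Rightarrow> real \<Rightarrow> (real set \<Rightarrow> real) \<Rightarrow> ereal" where
  "seller_utility I \<beta> H B x q p = sales I \<beta> H B q p * ereal (q - c x)"

text \<open>
  Optimality of the buyers' decisions is built into \<^const>\<open>demand\<close>. Together, the three clauses
  on \<open>\<beta> B\<close> say that it is the probability measure obtained by conditioning \<open>\<phi>\<close> on \<open>H B\<close>.
\<close>

definition equilibrium ::
  "real set set \<Rightarrow> (real set \<Rightarrow> real) \<Rightarrow> (real set \<Rightarrow> real set) \<Rightarrow>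
     (real set \<Rightarrow> real measure) \<Rightarrow> bool" where
  "equilibrium I p H \<beta> \<longleftrightarrow>
     (\<forall>B\<in>I.
        p B > 0 \<and>
        H B \<subseteq> B \<and> H B \<in> sets \<phi> \<and>
        seller_mass H B > 0 \<and>
        demand I \<beta> B p > 0 \<and>
        (\<forall>x\<in>H B. \<forall>q\<ge>0. seller_utility I \<beta> H B x q p \<le> seller_utility I \<beta> H B x (p B) p) \<and>
        (\<forall>x\<in>B. x \<in> H B \<longleftrightarrow> seller_utility I \<beta> H B x (p B) p \<ge> 0) \<and>
        prob_space (\<beta> B) \<and> sets (\<beta> B) = sets \<phi> \<and>
        (\<forall>S\<in>sets \<phi>. measure (\<beta> B) S = measure \<phi> (S \<inter> H B) / measure \<phi> (H B)) \<and>
        ereal (seller_mass H B) * sales I \<beta> H B (p B) p = ereal (demand I \<beta> B p))"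

definition implementable :: "real set set \<Rightarrow> bool" where
  "implementable I \<longleftrightarrow> info_structure I \<and> (\<exists>p H \<beta>. equilibrium I p H \<beta>)"

definition revenue_at ::
  "real set set \<Rightarrow> (real set \<Rightarrow> real) \<Rightarrow> (real set \<Rightarrow> real set) \<Rightarrow>
     (real set \<Rightarrow> real measure) \<Rightarrow> ereal" where
  "revenue_at I p H \<beta> =
     (\<Sum>B\<in>I. ereal (p B) *
        min (ereal (demand I \<beta> B p)) (ereal (seller_mass H B) * sales I \<beta> H B (p B) p))"

text \<open>
  For implementable \<open>I\<close> the equilibrium prices, participation sets, beliefs and demands on the
  members of \<open>I\<close> are unique, so all equilibria under \<open>I\<close> have the same revenue; for other \<open>I\<close>
  the value of \<open>revenue I\<close> is unspecified.
\<close>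

definition revenue :: "real set set \<Rightarrow> ereal" where
  "revenue I = (THE r. \<exists>p H \<beta>. equilibrium I p H \<beta> \<and> r = revenue_at I p H \<beta>)"

end

end

(*
  In an equilibrium, undercutting forces the price of B down to the cost of its cheapest cell, and
  only that cell participates. Hence an equilibrium is determined by I, and it exists iff every
  member of I has positive demand at the resulting prices and qualities.

  Let B be the most expensive member of I and C the next one, with prices p and expected
  qualities q. Types buying B would buy C if B were withdrawn, and they lie above
  t = (p B - p C) / (q B - q C), so withdrawing B lowers the revenue by at most
  (p B - p C) * (1 - F t). The revenue p * (1 - F (p / q)) of a single offer (p, q) is the
  perspective function of the concave function m * (1 - F m), hence superadditive in (p, q).
  By induction on the number of members, {B} alone earns at least as much as I; and there are
  finitely many candidates B.
*)

theory Submission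
  imports Defs
begin

section \<open>Types choosing an offer\<close>

text \<open>Prices and qualities are plain functions on an arbitrary index type, so that revenues
  can be compared without beliefs or equilibria. As in \<open>demand\<close>, an indifferent type
  counts for each of its best offers.\<close>

definition chosen :: "real set \<Rightarrow> 'b set \<Rightarrow> ('b \<Rightarrow> real) \<Rightarrow> ('b \<Rightarrow> real) \<Rightarrow> 'b \<Rightarrow> real set" where
  "chosen T J q p B = {m \<in> T. p B \<le> m * q B \<and> (\<forall>j\<in>J. m * q j - p j \<le> m * q B - p B)}"

lemma chosen_antimono: "J \<subseteq> K \<Longrightarrow> chosen T K q p B \<subseteq> chosen T J q p B"
  unfolding chosen_def by blast

lemma chosen_cong:
  assumes "B \<in> J" "\<And>j. j \<in> J \<Longrightarrow> q j = q' j" "\<And>j. j \<in> J \<Longrightarrow> p j = p' j"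
  shows "chosen T J q p B = chosen T J q' p' B"
  using assms unfolding chosen_def by auto

lemma chosen_borel:
  assumes "finite J" "T \<in> sets borel"
  shows "chosen T J q p B \<in> sets borel"
proof -
  have [measurable]: "T \<in> sets borel" by fact
  \<comment> \<open>Removing a finite union of complements, rather than intersecting over
    \<open>J\<close>, also covers \<open>J = {}\<close>.\<close>
  have "chosen T J q p B =
      (T \<inter> {m. p B \<le> m * q B}) - (\<Union>j\<in>J. - {m. m * q j - p j \<le> m * q B - p B})"
    unfolding chosen_def by auto
  also have "\<dots> \<in> sets borel"
    using assms(1) by (intro sets.Diff sets.finite_UN) measurable
  finally show ?thesis .
qed

context market
begin

section \<open>The distribution of buyer types\<close>

lemma F_mono: "x \<le> y \<Longrightarrow> F x \<le> F y"
proof -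
  assume xy: "x \<le> y"
  \<comment> \<open>Clamping to \<open>{a..b}\<close> does not change \<open>F\<close>, which is
    constant on either side of the interval; so monotonicity carries over to the whole line.\<close>
  define k where "k z = min b (max a z)" for z
  have F_k: "F z = F (k z)" for z
    using F_below[of z] F_above[of z] F_below[of a] F_above[of b] a_less_b
    unfolding k_def by (auto simp: min_def max_def)
  have "k x \<in> {a..b}" "k y \<in> {a..b}" "k x \<le> k y"
    using a_less_b xy unfolding k_def by auto
  then have "F (k x) \<le> F (k y)"
    using strict_mono_onD[OF F_strict_mono, of "k x" "k y"]
    by (cases "k x = k y") auto
  then show ?thesis using F_k by metis
qed

lemma F_nonneg: "0 \<le> F x"
  using F_mono[of "min x a" x] F_below[of "min x a"] by simp

abbreviation N :: "real measure" where "N \<equiv> interval_measure F"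

lemma F_right_continuous: "continuous (at_right x) F"
  using F_continuous by (simp add: continuous_on_eq_continuous_at continuous_at_imp_continuous_at_within)

lemma F_at_bot: "(F \<longlongrightarrow> 0) at_bot"
  by (rule tendsto_eventually) (use F_below in \<open>auto simp: eventually_at_bot_linorder\<close>)

lemma F_at_top: "(F \<longlongrightarrow> 1) at_top"
  by (rule tendsto_eventually) (use F_above in \<open>auto simp: eventually_at_top_linorder\<close>)

sublocale types: real_distribution N
  by (rule real_distribution_interval_measure[OF F_mono F_right_continuous F_at_bot F_at_top])

text \<open>Continuity of \<open>F\<close> excludes atoms. This makes a tie at a single type
  negligible.\<close>

lemma measure_singleton: "measure N {x} = 0"
proof -
  have "cdf N = F"
    by (rule cdf_interval_measure[OF F_mono F_right_continuous F_at_bot])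
  moreover have "isCont F x"
    using F_continuous by (simp add: continuous_on_eq_continuous_at)
  ultimately show ?thesis using types.isCont_cdf by metis
qed

lemma measure_types_above:
  assumes "t \<le> b"
  shows "measure N {m \<in> {a..b}. t \<le> m} = 1 - F t"
proof -
  \<comment> \<open>\<open>t\<close> may lie below \<open>a\<close>; the set then starts at
    \<open>a\<close>, and \<open>F\<close> vanishes at both points.\<close>
  define s where "s = max a t"
  have s: "s \<le> b" "F s = F t"
    using assms a_less_b F_below[of t] F_below[of a] unfolding s_def by (auto simp: max_def)
  have "{m \<in> {a..b}. t \<le> m} = {s} \<union> {s<..b}"
    using s unfolding s_def by auto
  moreover have "measure N ({s} \<union> {s<..b}) = measure N {s} + measure N {s<..b}"
    by (rule types.finite_measure_Union) auto
  ultimately have "measure N {m \<in> {a..b}. t \<le> m} = measure N {s} + measure N {s<..b}"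
    by (simp only:)
  also have "measure N {s<..b} = F b - F s"
    by (rule measure_interval_measure_Ioc[OF s(1) F_mono F_right_continuous])
  finally show ?thesis
    using s F_above[of b] by (simp add: measure_singleton)
qed

section \<open>Convexity and the revenue of a single offer\<close>

text \<open>Ratios of price to quality may fall below \<open>a\<close>, where the assumption says
  nothing. There the function is 0, and extending a nonnegative convex function that vanishes at
  \<open>a\<close> by 0 to the left keeps it convex.\<close>

lemma F_times_id_convex:
  assumes cvx: "convex_on {a..b} (\<lambda>m. F m * m)"
  shows "convex_on {0..b} (\<lambda>m. F m * m)"
proof (rule convex_on_linorderI)
  fix t x y :: real
  assume t: "0 < t" "t < 1" and xy: "x \<in> {0..b}" "y \<in> {0..b}" "x < y"
  let ?h = "\<lambda>m. F m * m"
  define z where "z = (1 - t) * x + t * y"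
  have h0: "0 \<le> ?h m" if "0 \<le> m" for m
    using that F_nonneg by simp
  have ha: "?h m = 0" if "m \<le> a" for m
    using that F_below by simp
  have zx: "z - x = t * (y - x)" and zy: "y - z = (1 - t) * (y - x)"
    unfolding z_def by (simp_all add: algebra_simps)
  have "0 < z - x" "0 < y - z"
    unfolding zx zy using t xy by simp_all
  have "?h z \<le> (1 - t) * ?h x + t * ?h y"
  proof (cases "z \<le> a")
    case True
    have "0 \<le> (1 - t) * ?h x + t * ?h y"
      using t xy F_nonneg by (intro add_nonneg_nonneg mult_nonneg_nonneg) auto
    then show ?thesis unfolding ha[OF True] .
  next
    case za: False
    show ?thesis
    proof (cases "a \<le> x")
      case True
      then show ?thesis
        using convex_onD[OF cvx, of t x y] t xy unfolding z_def by auto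
    next
      case False
      \<comment> \<open>Here \<open>x < a < z\<close>. Seen from \<open>a\<close> instead of
        \<open>x\<close>, the point \<open>z\<close> has a weight \<open>s \<le> t\<close> at
        \<open>y\<close>, and the function is 0 at both left ends.\<close>
      define s where "s = (z - a) / (y - a)"
      have ya: "0 < y - a" using za \<open>0 < y - z\<close> by simp
      have "s * (y - a) = z - a" using ya unfolding s_def by simp
      then have s: "z = (1 - s) * a + s * y" by (simp add: algebra_simps)
      have s01: "0 \<le> s" "s \<le> 1"
        using za ya \<open>0 < y - z\<close> unfolding s_def by (auto simp: divide_le_eq)
      have "s \<le> t"
      proof -
        have "z - a \<le> t * (y - a)"
        proof -
          have "t * (y - a) - (z - a) = (1 - t) * (a - x)"
            unfolding z_def by (simp add: algebra_simps)
          moreover have "0 \<le> (1 - t) * (a - x)" using t False by simp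
          ultimately show ?thesis by linarith
        qed
        then show ?thesis unfolding s_def using ya by (simp add: divide_le_eq)
      qed
      have "?h z \<le> (1 - s) * ?h a + s * ?h y"
        using convex_onD[OF cvx s01, of a y] a_less_b xy ya unfolding s by auto
      also have "\<dots> = s * ?h y" using ha[of a] by simp
      also have "\<dots> \<le> t * ?h y"
        using \<open>s \<le> t\<close> h0[of y] xy by (intro mult_right_mono) auto
      finally show ?thesis using ha[of x] False by auto
    qed
  qed
  then show "F ((1 - t) *\<^sub>R x + t *\<^sub>R y) * ((1 - t) *\<^sub>R x + t *\<^sub>R y)
      \<le> (1 - t) * (F x * x) + t * (F y * y)"
    unfolding z_def by simp
qed simp

text \<open>The ratio of the sums is the average of \<open>p1 / q1\<close> and
  \<open>p2 / q2\<close> with weights proportional to \<open>q1\<close> and \<open>q2\<close>.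
  Convexity of \<open>F m * m\<close> at this average, multiplied by \<open>q1 + q2\<close>, is the
  claim up to the common term \<open>p1 + p2\<close>.\<close>

lemma monopoly_revenue_superadditive:
  assumes cvx: "convex_on {a..b} (\<lambda>m. F m * m)"
    and q: "0 < q1" "0 < q2" and p: "0 \<le> p1" "0 \<le> p2"
    and le: "p1 / q1 \<le> b" "p2 / q2 \<le> b"
  shows "p1 * (1 - F (p1 / q1)) + p2 * (1 - F (p2 / q2))
    \<le> (p1 + p2) * (1 - F ((p1 + p2) / (q1 + q2)))"
proof -
  define t1 where "t1 = p1 / q1"
  define t2 where "t2 = p2 / q2"
  define u where "u = q2 / (q1 + q2)"
  define t where "t = (p1 + p2) / (q1 + q2)"
  have peq: "p1 = q1 * t1" "p2 = q2 * t2" "p1 + p2 = (q1 + q2) * t"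
    unfolding t1_def t2_def t_def using q by (auto simp: field_simps)
  have u: "0 \<le> u" "u \<le> 1" "(q1 + q2) * u = q2" "(q1 + q2) * (1 - u) = q1"
    unfolding u_def using q by (auto simp: field_simps)
  have "(q1 + q2) * ((1 - u) * t1 + u * t2) = ((q1 + q2) * (1 - u)) * t1 + ((q1 + q2) * u) * t2"
    by (simp only: distrib_left mult.assoc)
  also have "\<dots> = (q1 + q2) * t" using u peq by simp
  finally have t: "t = (1 - u) * t1 + u * t2" using q by simp
  have "t1 \<in> {0..b}" "t2 \<in> {0..b}"
    using q p le unfolding t1_def t2_def by auto
  then have "F t * t \<le> (1 - u) * (F t1 * t1) + u * (F t2 * t2)"
    using convex_onD[OF F_times_id_convex[OF cvx] u(1,2), of t1 t2] unfolding t by simp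
  then have "(q1 + q2) * (F t * t) \<le> (q1 + q2) * ((1 - u) * (F t1 * t1) + u * (F t2 * t2))"
    using q by (intro mult_left_mono) auto
  also have "\<dots> = ((q1 + q2) * (1 - u)) * (F t1 * t1) + ((q1 + q2) * u) * (F t2 * t2)"
    by (simp only: distrib_left mult.assoc)
  finally have "(p1 + p2) * F t \<le> p1 * F t1 + p2 * F t2"
    unfolding peq(3) u(3,4) unfolding peq(1,2) by (simp add: mult_ac)
  then show ?thesis
    unfolding t_def t1_def t2_def by (simp add: algebra_simps)
qed

section \<open>Revenue comparison for abstract offers\<close>

abbreviation share :: "'b set \<Rightarrow> ('b \<Rightarrow> real) \<Rightarrow> ('b \<Rightarrow> real) \<Rightarrow> 'b \<Rightarrow> real" where
  "share J q p B \<equiv> measure N (chosen {a..b} J q p B)"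

lemma share_antimono: "finite K \<Longrightarrow> J \<subseteq> K \<Longrightarrow> share K q p B \<le> share J q p B"
  using chosen_borel[of J "{a..b}" q p B] finite_subset[of J K]
  by (intro types.finite_measure_mono chosen_antimono) simp_all

lemma share_pos_obtain:
  assumes "0 < share J q p B"
  obtains m where "m \<in> chosen {a..b} J q p B"
proof -
  have "chosen {a..b} J q p B \<noteq> {}"
  proof
    assume "chosen {a..b} J q p B = {}"
    then show False using assms by simp
  qed
  then show ?thesis using that by blast
qed

lemma share_single:
  assumes "0 < q B" "p B / q B \<le> b"
  shows "share {B} q p B = 1 - F (p B / q B)"
proof -
  have "chosen {a..b} {B} q p B = {m \<in> {a..b}. p B / q B \<le> m}"
    unfolding chosen_def using assms(1) by (auto simp: field_simps)
  then show ?thesis using measure_types_above[OF assms(2)] by simp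
qed

text \<open>One buying type \<open>m\<close> is enough: \<open>0 < p B \<le> m * q B\<close> with
  \<open>0 \<le> m \<le> b\<close>.\<close>

lemma share_pos_quality:
  assumes "0 < share J q p B" "0 < p B"
  shows "0 < q B" "p B / q B \<le> b"
proof -
  obtain m where m: "m \<in> chosen {a..b} J q p B"
    by (rule share_pos_obtain[OF assms(1)])
  then have "0 < m * q B" "0 \<le> m" "p B \<le> m * q B" "m \<le> b"
    using assms(2) a_nonneg unfolding chosen_def by auto
  then show q: "0 < q B" by (simp add: zero_less_mult_iff)
  have "p B / q B \<le> m"
    using \<open>p B \<le> m * q B\<close> q by (simp add: divide_le_eq)
  then show "p B / q B \<le> b" using \<open>m \<le> b\<close> by linarith
qed

text \<open>A nonnegative type that accepts the higher price must be compensated by a positive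
  \<open>m * (q B - q j)\<close>.\<close>

lemma chosen_quality_mono:
  assumes "m \<in> chosen {a..b} J q p B" "j \<in> J" "p j < p B"
  shows "q j < q B"
proof -
  have "0 < m * (q B - q j)" "0 \<le> m"
    using assms a_nonneg unfolding chosen_def by (auto simp: algebra_simps)
  then show ?thesis by (simp add: zero_less_mult_iff)
qed

text \<open>Distinct prices, together with positive shares, give distinct qualities, so the
  threshold between the two top offers is well defined. The conclusion records that \<open>B\<close>
  is the most expensive offer because the induction hypothesis must deliver the runner-up
  \<open>C\<close> and not just some member of \<open>K\<close>.\<close>

lemma revenue_le_top:
  fixes p q :: "'b \<Rightarrow> real"
  assumes cvx: "convex_on {a..b} (\<lambda>m. F m * m)"
    and "finite J" "J \<noteq> {}" "inj_on p J"
    and "\<And>j. j \<in> J \<Longrightarrow> 0 < p j"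
    and "\<And>j. j \<in> J \<Longrightarrow> 0 < share J q p j"
  shows "\<exists>B\<in>J. (\<forall>j\<in>J. p j \<le> p B) \<and>
    (\<Sum>j\<in>J. p j * share J q p j) \<le> p B * (1 - F (p B / q B))"
  using assms(2-)
proof (induction "card J" arbitrary: J rule: less_induct)
  case less
  note fin = \<open>finite J\<close> and inj = \<open>inj_on p J\<close>
    and pos = less.prems(4) and share_pos = less.prems(5)
  obtain B where B: "B \<in> J" "\<And>j. j \<in> J \<Longrightarrow> p j \<le> p B"
  proof -
    have "Max (p ` J) \<in> p ` J" using fin \<open>J \<noteq> {}\<close> by simp
    then obtain B where "B \<in> J" "p B = Max (p ` J)" by force
    then show ?thesis using that fin by (metis Max_ge finite_imageI imageI)
  qed
  define K where "K = J - {B}"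
  have J: "J = insert B K" "B \<notin> K" "finite K" "K \<subseteq> J" using B fin unfolding K_def by auto
  note qB = share_pos_quality[OF share_pos[OF B(1)] pos[OF B(1)]]
  show ?case
  proof (cases "K = {}")
    case True
    then have "J = {B}" using J by simp
    then show ?thesis using share_single[where q=q and p=p, OF qB] by auto
  next
    case False
    \<comment> \<open>Withdrawing \<open>B\<close> can only enlarge the other shares, so
      \<open>K\<close> inherits the hypotheses.\<close>
    have K_pos: "0 < share K q p j" if "j \<in> K" for j
      using share_antimono[OF fin J(4), of q p j] share_pos[of j] that J(4) by fastforce
    have "card K < card J" using J(1-3) by simp
    then have "\<exists>C\<in>K. (\<forall>j\<in>K. p j \<le> p C) \<and>
        (\<Sum>j\<in>K. p j * share K q p j) \<le> p C * (1 - F (p C / q C))"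
      using pos J(4) K_pos by (intro less.hyps J(3) False inj_on_subset[OF inj J(4)]) auto
    then obtain C where C: "C \<in> K" "\<And>j. j \<in> K \<Longrightarrow> p j \<le> p C"
      and IH: "(\<Sum>j\<in>K. p j * share K q p j) \<le> p C * (1 - F (p C / q C))"
      by blast
    have CJ: "C \<in> J" using C J by auto
    have pCB: "p C < p B"
      using B(2)[OF CJ] inj_onD[OF inj _ CJ B(1)] C(1) J(2) by force
    note qC = share_pos_quality[OF share_pos[OF CJ] pos[OF CJ]]
    obtain mC where mC: "mC \<in> chosen {a..b} J q p C"
      by (rule share_pos_obtain[OF share_pos[OF CJ]])
    obtain mB where mB: "mB \<in> chosen {a..b} J q p B"
      by (rule share_pos_obtain[OF share_pos[OF B(1)]])
    have qCB: "q C < q B" using chosen_quality_mono[OF mB CJ pCB] .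
    \<comment> \<open>The type indifferent between \<open>B\<close> and \<open>C\<close>: buyers of
      \<open>B\<close> lie above it, buyers of \<open>C\<close> below it.\<close>
    define s where "s = (p B - p C) / (q B - q C)"
    have s_le: "s \<le> m" if "m \<in> chosen {a..b} J q p B" for m
      using that CJ qCB unfolding chosen_def s_def by (auto simp: divide_le_eq algebra_simps)
    have le_s: "m \<le> s" if "m \<in> chosen {a..b} J q p C" for m
      using that B(1) qCB unfolding chosen_def s_def by (auto simp: le_divide_eq algebra_simps)
    have "s \<le> b" using s_le[OF mB] mB unfolding chosen_def by auto
    have "share J q p B \<le> measure N {m \<in> {a..b}. s \<le> m}"
      using s_le by (intro types.finite_measure_mono) (auto simp: chosen_def)
    then have shareB: "share J q p B \<le> 1 - F s"
      using measure_types_above[OF \<open>s \<le> b\<close>] by simp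
    \<comment> \<open>Single crossing with the witness \<open>mC\<close>: it prefers
      \<open>C\<close> to every cheaper, hence worse, offer and to not buying. A type
      \<open>m \<ge> mC\<close> values the extra quality at least as much.\<close>
    have sub: "chosen {a..b} J q p B \<subseteq> chosen {a..b} K q p C"
    proof
      fix m assume m: "m \<in> chosen {a..b} J q p B"
      have le: "mC \<le> m" using s_le[OF m] le_s[OF mC] by simp
      have "m * q j - p j \<le> m * q C - p C" if j: "j \<in> K" for j
      proof (cases "j = C")
        case False
        have "j \<in> J" using j J by auto
        have "p j < p C" using C(2)[OF j] inj_onD[OF inj _ \<open>j \<in> J\<close> CJ] False by force
        then have "q j < q C" using chosen_quality_mono[OF mC \<open>j \<in> J\<close>] by simp
        then have "mC * (q C - q j) \<le> m * (q C - q j)" using le by (intro mult_right_mono) auto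
        moreover have "mC * q j - p j \<le> mC * q C - p C"
          using mC \<open>j \<in> J\<close> unfolding chosen_def by auto
        ultimately show ?thesis by (simp add: algebra_simps)
      qed simp
      moreover have "mC * q C \<le> m * q C" using le qC(1) by (intro mult_right_mono) auto
      then have "p C \<le> m * q C" using mC unfolding chosen_def by auto
      ultimately show "m \<in> chosen {a..b} K q p C" using m unfolding chosen_def by auto
    qed
    have borel: "chosen {a..b} J q p j \<in> sets borel" "chosen {a..b} K q p j \<in> sets borel" for j
      using fin J(3) by (auto intro: chosen_borel)
    \<comment> \<open>Both sets of buyers would choose \<open>C\<close> from \<open>K\<close>, and
      they meet at most in \<open>s\<close>, which has no mass.\<close>
    have shareBC: "share J q p B + share J q p C \<le> share K q p C"
    proof -
      let ?X = "chosen {a..b} J q p B" and ?Y = "chosen {a..b} J q p C"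
      have disj: "(?X - {s}) \<inter> ?Y = {}" using s_le le_s by fastforce
      have "?X \<subseteq> (?X - {s}) \<union> {s}" by auto
      then have "measure N ?X \<le> measure N ((?X - {s}) \<union> {s})"
        using borel by (intro types.finite_measure_mono) auto
      also have "\<dots> = measure N (?X - {s}) + measure N {s}"
        using borel by (intro types.finite_measure_Union) auto
      finally have "measure N ?X + measure N ?Y \<le> measure N (?X - {s}) + measure N ?Y"
        by (simp add: measure_singleton)
      also have "\<dots> = measure N ((?X - {s}) \<union> ?Y)"
        using borel disj by (intro types.finite_measure_Union[symmetric]) auto
      also have "\<dots> \<le> share K q p C"
      proof (rule types.finite_measure_mono)
        show "(?X - {s}) \<union> ?Y \<subseteq> chosen {a..b} K q p C"
          using sub chosen_antimono[OF J(4), of "{a..b}" q p C] by blast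
      qed (simp add: borel)
      finally show ?thesis .
    qed
    have "(\<Sum>j\<in>J. p j * share J q p j) =
      p B * share J q p B + (p C * share J q p C + (\<Sum>j\<in>K-{C}. p j * share J q p j))"
      unfolding sum.remove[OF fin B(1)] K_def[symmetric] sum.remove[OF J(3) C(1)] ..
    also have "\<dots> \<le> p B * share J q p B +
      (p C * (share K q p C - share J q p B) + (\<Sum>j\<in>K-{C}. p j * share K q p j))"
    proof (intro add_mono order.refl)
      show "p C * share J q p C \<le> p C * (share K q p C - share J q p B)"
        using shareBC pos[OF CJ] by (intro mult_left_mono) auto
      show "(\<Sum>j\<in>K-{C}. p j * share J q p j) \<le> (\<Sum>j\<in>K-{C}. p j * share K q p j)"
      proof (intro sum_mono mult_left_mono)
        fix j assume "j \<in> K - {C}"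
        then show "0 \<le> p j" using pos[of j] J(4) by auto
      qed (rule share_antimono[OF fin J(4)])
    qed
    \<comment> \<open>Relative to \<open>K\<close>, the offer \<open>B\<close> gains at most the
      price difference on its own buyers.\<close>
    also have "\<dots> = (p B - p C) * share J q p B + (\<Sum>j\<in>K. p j * share K q p j)"
      unfolding sum.remove[OF J(3) C(1)] by (simp add: algebra_simps)
    also have "\<dots> \<le> (p B - p C) * (1 - F s) + p C * (1 - F (p C / q C))"
      using IH shareB pCB by (intro add_mono mult_left_mono) auto
    \<comment> \<open>\<open>B\<close> is split into \<open>C\<close> and a virtual upgrade of price
      \<open>p B - p C\<close> and quality \<open>q B - q C\<close>, whose threshold is
      \<open>s\<close>.\<close>
    also have "\<dots> \<le> (p B - p C + p C) * (1 - F ((p B - p C + p C) / (q B - q C + q C)))"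
      unfolding s_def
      using qCB qC pCB pos[OF CJ] \<open>s \<le> b\<close>
      by (intro monopoly_revenue_superadditive[OF cvx]) (auto simp: s_def)
    finally show ?thesis using B by (intro bexI[of _ B]) auto
  qed
qed

section \<open>Demand, cheapest sellers and uniqueness of equilibrium\<close>

text \<open>A member of the finite set \<open>I\<close> attains \<open>Max\<close> iff it bounds all
  utilities, so on \<open>{a..b}\<close> the integrand is the indicator of
  \<open>chosen\<close>.\<close>

lemma demand_eq_share:
  assumes "finite I" "B \<in> I"
  shows "demand I \<beta> B p = share I (\<lambda>B. \<integral>x. x \<partial>\<beta> B) p B"
proof -
  let ?q = "\<lambda>B. \<integral>x. x \<partial>\<beta> B"
  have max: "buyer_utility \<beta> m B (p B) = Max ((\<lambda>B'. buyer_utility \<beta> m B' (p B')) ` I) \<longleftrightarrow>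
      (\<forall>j\<in>I. m * ?q j - p j \<le> m * ?q B - p B)" for m
  proof -
    have "buyer_utility \<beta> m B (p B) = Max ((\<lambda>B'. buyer_utility \<beta> m B' (p B')) ` I) \<longleftrightarrow>
        (\<forall>v\<in>(\<lambda>B'. buyer_utility \<beta> m B' (p B')) ` I. v \<le> buyer_utility \<beta> m B (p B))"
      using assms by (subst eq_commute, subst Max_eq_iff) auto
    then show ?thesis unfolding buyer_utility_def by simp
  qed
  have "demand I \<beta> B p = (\<integral>m. indicator (chosen {a..b} I ?q p B) m \<partial>N)"
    unfolding demand_def set_lebesgue_integral_def max
    by (intro Bochner_Integration.integral_cong)
      (auto simp: chosen_def buyer_utility_def indicator_def)
  also have "\<dots> = share I ?q p B" by simp
  finally show ?thesis .
qed

definition cheapest :: "real set \<Rightarrow> real set" where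
  "cheapest B = {x \<in> B. \<forall>y\<in>B. c x \<le> c y}"

text \<open>All elements of \<open>cheapest B\<close> have the same cost, so the choice made by
  \<open>SOME\<close> is immaterial once the set is nonempty.\<close>

definition floor_price :: "real set \<Rightarrow> real" where
  "floor_price B = c (SOME x. x \<in> cheapest B)"

definition posterior :: "real set \<Rightarrow> real measure" where
  "posterior B = uniform_measure \<phi> (cheapest B)"

definition quality :: "real set \<Rightarrow> real" where
  "quality B = (\<integral>x. x \<partial>posterior B)"

text \<open>There are only finitely many unions of cells; this bounds both the members of one
  structure and the candidates for the optimum.\<close>

lemma info_structure_subset: "info_structure I \<Longrightarrow> I \<subseteq> (\<lambda>S. \<Union>i\<in>S. A i) ` Pow {1..l}"
  unfolding info_structure_def by blast

lemma info_structure_finite: "info_structure I \<Longrightarrow> finite I"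
  by (rule finite_subset[OF info_structure_subset]) simp_all

lemma info_structure_single: "info_structure I \<Longrightarrow> B \<in> I \<Longrightarrow> info_structure {B}"
  unfolding info_structure_def by auto

lemma cell_nonempty: "i \<in> {1..l} \<Longrightarrow> A i \<noteq> {}"
  using cells_pos[of i] by auto

context
  fixes I B
  assumes I: "info_structure I" and B: "B \<in> I"
begin

text \<open>Cost is constant on cells and increases with the index, so the cell of least index in
  \<open>B\<close> is the cheapest. Measurability and positive mass of \<open>cheapest B\<close>
  follow.\<close>

lemma cheapest_cell: "\<exists>i\<in>{1..l}. cheapest B = A i"
proof -
  obtain S where S: "S \<subseteq> {1..l}" "B = (\<Union>i\<in>S. A i)" and "B \<noteq> {}"
    using I B unfolding info_structure_def by blast
  then have "S \<noteq> {}" "finite S" using finite_subset by auto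
  define i where "i = Min S"
  have i: "i \<in> S" "\<And>j. j \<in> S \<Longrightarrow> i \<le> j"
    using \<open>S \<noteq> {}\<close> \<open>finite S\<close> unfolding i_def by auto
  have il: "i \<in> {1..l}" using i S by auto
  have "cheapest B = A i"
  proof (intro subset_antisym subsetI)
    fix x assume x: "x \<in> A i"
    have "c x \<le> c y" if "j \<in> S" "y \<in> A j" for j y
    proof (cases "i = j")
      case True
      then show ?thesis using cost_const[OF il x] that by simp
    next
      case False
      then show ?thesis using cost_less[OF il _ _ x, of j y] that S i(2)[of j] by force
    qed
    then show "x \<in> cheapest B" using x i S unfolding cheapest_def by auto
  next
    fix x assume x: "x \<in> cheapest B"
    then obtain j where j: "j \<in> S" "x \<in> A j" unfolding cheapest_def S by auto
    obtain y where y: "y \<in> A i" using cell_nonempty[OF il] by auto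
    have "c x \<le> c y" using x y i S unfolding cheapest_def by auto
    then have "\<not> i < j" using cost_less[OF il _ _ y j(2)] j S by force
    then show "x \<in> A i" using i(2)[OF j(1)] j by simp
  qed
  then show ?thesis using il by blast
qed

lemma cheapest_sets: "cheapest B \<in> sets \<phi>"
  using cheapest_cell cells_measurable by metis

lemma cheapest_pos: "0 < measure \<phi> (cheapest B)"
  using cheapest_cell cells_pos by metis

lemma cheapest_subset: "cheapest B \<subseteq> B"
  unfolding cheapest_def by auto

lemma member_subset: "B \<subseteq> {0..xbar}"
proof -
  obtain S where "S \<subseteq> {1..l}" "B = (\<Union>i\<in>S. A i)"
    using I B unfolding info_structure_def by blast
  then show ?thesis unfolding cells_cover[symmetric] by (simp add: UN_mono)
qed

lemma cost_cheapest: "x \<in> cheapest B \<Longrightarrow> c x = floor_price B"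
proof -
  assume x: "x \<in> cheapest B"
  then have "(SOME x. x \<in> cheapest B) \<in> cheapest B" by (rule someI)
  then show ?thesis using x unfolding floor_price_def cheapest_def by (auto intro: order.antisym)
qed

lemma cheapest_nonempty: "\<exists>x. x \<in> cheapest B"
proof (rule ccontr)
  assume "\<nexists>x. x \<in> cheapest B"
  then have "cheapest B = {}" by blast
  then show False using cheapest_pos by simp
qed

lemma floor_price_le: "y \<in> B \<Longrightarrow> floor_price B \<le> c y"
proof -
  assume y: "y \<in> B"
  obtain x where x: "x \<in> cheapest B" using cheapest_nonempty by blast
  then show ?thesis using y cost_cheapest[OF x] unfolding cheapest_def by auto
qed

text \<open>This is the form of the entry condition: with positive sales at the floor price, these
  are the sellers without a loss.\<close>

lemma cheapest_eq: "cheapest B = {x \<in> B. c x \<le> floor_price B}"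
proof (intro subset_antisym subsetI)
  fix x assume "x \<in> cheapest B"
  then show "x \<in> {x \<in> B. c x \<le> floor_price B}" using cost_cheapest cheapest_subset by auto
next
  fix x assume x: "x \<in> {x \<in> B. c x \<le> floor_price B}"
  have "c x \<le> c y" if "y \<in> B" for y
    using x floor_price_le[OF that] by auto
  then show "x \<in> cheapest B" using x unfolding cheapest_def by auto
qed

lemma floor_price_pos: "0 < floor_price B"
proof -
  obtain x where x: "x \<in> cheapest B" using cheapest_nonempty by blast
  then have "0 < c x" using cheapest_subset member_subset by (intro cost_pos) blast
  then show ?thesis using cost_cheapest[OF x] by simp
qed

lemma measure_posterior:
  "S \<in> sets \<phi> \<Longrightarrow> measure (posterior B) S = measure \<phi> (S \<inter> cheapest B) / measure \<phi> (cheapest B)"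
proof -
  assume S: "S \<in> sets \<phi>"
  interpret prob_space \<phi> by (rule prob_phi)
  show ?thesis
    unfolding posterior_def using S cheapest_pos
    by (subst measure_uniform_measure) (auto simp: emeasure_eq_measure Int_commute)
qed

lemma prob_space_posterior: "prob_space (posterior B)"
proof -
  interpret prob_space \<phi> by (rule prob_phi)
  show ?thesis
    unfolding posterior_def using cheapest_pos
    by (intro prob_space_uniform_measure) (auto simp: emeasure_eq_measure)
qed

lemma sets_posterior: "sets (posterior B) = sets \<phi>"
  unfolding posterior_def by simp

text \<open>
  Charging marginally less than \<open>p B\<close> attracts infinite demand, so participating sellers must
  earn zero profit, and any cheaper seller of \<open>B\<close> would have entered.
\<close>

lemma equilibrium_unique:
  assumes eq: "equilibrium I p H \<beta>"
  shows "p B = floor_price B" "H B = cheapest B" "\<beta> B = posterior B"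
proof -
  define D where "D = demand I \<beta> B p"
  define M where "M = seller_mass H B"
  have pos: "0 < D" "0 < M" "0 < p B" and "H B \<subseteq> B"
    using eq B unfolding equilibrium_def D_def M_def by auto
  \<comment> \<open>Positive demand and mass rule out the branches of \<open>sales\<close> with
    value 0 or \<open>\<infinity>\<close>.\<close>
  have util: "seller_utility I \<beta> H B x (p B) p = ereal (D / M * (p B - c x))" for x
    using pos unfolding seller_utility_def sales_def D_def M_def by auto
  have "\<forall>x\<in>H B. \<forall>r\<ge>0. seller_utility I \<beta> H B x r p \<le> seller_utility I \<beta> H B x (p B) p"
    and enter: "\<forall>x\<in>B. x \<in> H B \<longleftrightarrow> 0 \<le> seller_utility I \<beta> H B x (p B) p"
    using bspec[OF eq[unfolded equilibrium_def] B] by - (elim conjE, assumption)+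
  then have opt: "seller_utility I \<beta> H B x r p \<le> ereal (D / M * (p B - c x))"
    if "x \<in> H B" "0 \<le> r" for x r
    using that unfolding util by simp
  have "0 < D / M" using pos by simp
  then have in_H: "x \<in> H B \<longleftrightarrow> c x \<le> p B" if "x \<in> B" for x
    using bspec[OF enter that] unfolding util by (simp add: zero_le_mult_iff del: times_divide_eq_left)
  have ge: "p B \<le> c x" if x: "x \<in> H B" for x
  proof (rule ccontr)
    assume less: "\<not> p B \<le> c x"
    \<comment> \<open>Halfway between cost and price the margin is still positive, so infinite sales
      give infinite utility, against a finite one at \<open>p B\<close>.\<close>
    define r where "r = (c x + p B) / 2"
    have "0 < c x" using x \<open>H B \<subseteq> B\<close> member_subset by (intro cost_pos) blast
    then have r: "0 \<le> r" "r < p B" "c x < r" using less pos unfolding r_def by auto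
    have "seller_utility I \<beta> H B x r p = \<infinity>"
      using r pos unfolding seller_utility_def sales_def D_def by auto
    then show False using opt[OF x r(1)] by simp
  qed
  have "H B \<noteq> {}" using pos unfolding M_def seller_mass_def by auto
  then obtain x where x: "x \<in> H B" by blast
  then have cx: "c x = p B" "x \<in> B" using in_H ge \<open>H B \<subseteq> B\<close> by (auto intro: order.antisym)
  have "p B \<le> c y" if "y \<in> B" for y
    using in_H[OF that] ge[of y] by linarith
  then have "x \<in> cheapest B" using cx unfolding cheapest_def by auto
  then show p: "p B = floor_price B" using cost_cheapest cx by simp
  show H: "H B = cheapest B"
    using in_H \<open>H B \<subseteq> B\<close> unfolding cheapest_eq p[symmetric] by auto
  interpret \<beta>: prob_space "\<beta> B" using eq B unfolding equilibrium_def by blast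
  interpret post: prob_space "posterior B" by (rule prob_space_posterior)
  have sets: "sets (\<beta> B) = sets \<phi>"
    and meas: "\<And>S. S \<in> sets \<phi> \<Longrightarrow> measure (\<beta> B) S = measure \<phi> (S \<inter> H B) / measure \<phi> (H B)"
    using eq B unfolding equilibrium_def by auto
  show "\<beta> B = posterior B"
    by (rule measure_eqI)
      (simp_all add: sets sets_posterior \<beta>.emeasure_eq_measure post.emeasure_eq_measure
        meas measure_posterior H)
qed

end

section \<open>Implementability and revenue\<close>

text \<open>Uniqueness applies to every member of \<open>I\<close>, so all competing prices and
  qualities are those of the floor-price candidate.\<close>

lemma demand_equilibrium:
  assumes "info_structure I" "B \<in> I" "equilibrium I p H \<beta>"
  shows "demand I \<beta> B p = share I quality floor_price B"
  unfolding demand_eq_share[OF info_structure_finite[OF assms(1)] assms(2)]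
  using equilibrium_unique[OF assms(1) _ assms(3)] assms(2)
  by (intro arg_cong[where f = "measure N"] chosen_cong) (auto simp: quality_def)

text \<open>At price equal to cost the participants earn 0. Undercutting sells an infinite quantity
  at a loss, overcharging sells nothing, and the other sellers would lose by entering.\<close>

lemma equilibrium_floor:
  assumes I: "info_structure I" and share: "\<And>B. B \<in> I \<Longrightarrow> 0 < share I quality floor_price B"
  shows "equilibrium I floor_price cheapest posterior"
  unfolding equilibrium_def
proof (intro ballI conjI allI impI)
  fix B assume B: "B \<in> I"
  note props = cheapest_pos[OF I B] cheapest_eq[OF I B]
  have D: "demand I posterior B floor_price = share I quality floor_price B"
    unfolding demand_eq_share[OF info_structure_finite[OF I] B] quality_def ..
  show dpos: "0 < demand I posterior B floor_price" using share[OF B] D by simp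
  show "0 < floor_price B" by (rule floor_price_pos[OF I B])
  show "cheapest B \<subseteq> B" by (rule cheapest_subset[OF I B])
  show "cheapest B \<in> sets \<phi>" by (rule cheapest_sets[OF I B])
  show mpos: "0 < seller_mass cheapest B" unfolding seller_mass_def by (rule props)
  show "prob_space (posterior B)" by (rule prob_space_posterior[OF I B])
  show "sets (posterior B) = sets \<phi>" by (rule sets_posterior[OF I B])
  show "measure (posterior B) S = measure \<phi> (S \<inter> cheapest B) / measure \<phi> (cheapest B)"
    if "S \<in> sets \<phi>" for S by (rule measure_posterior[OF I B that])
  have sales: "sales I posterior cheapest B (floor_price B) floor_price =
      ereal (demand I posterior B floor_price / seller_mass cheapest B)"
    using dpos mpos unfolding sales_def by auto
  then show "ereal (seller_mass cheapest B) * sales I posterior cheapest B (floor_price B) floor_price =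
      ereal (demand I posterior B floor_price)"
    using mpos by simp
  have util: "seller_utility I posterior cheapest B x (floor_price B) floor_price =
      ereal (demand I posterior B floor_price / seller_mass cheapest B * (floor_price B - c x))" for x
    unfolding seller_utility_def sales by simp
  have ratio: "0 < demand I posterior B floor_price / seller_mass cheapest B"
    using dpos mpos by simp
  show "x \<in> cheapest B \<longleftrightarrow>
      0 \<le> seller_utility I posterior cheapest B x (floor_price B) floor_price"
    if "x \<in> B" for x
    unfolding util using ratio that props(2)
    by (simp add: zero_le_mult_iff del: times_divide_eq_left)
  fix x and r :: real assume x: "x \<in> cheapest B" and "0 \<le> r"
  show "seller_utility I posterior cheapest B x r floor_price
      \<le> seller_utility I posterior cheapest B x (floor_price B) floor_price"
    unfolding util cost_cheapest[OF I B x]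
    using dpos mpos unfolding seller_utility_def sales_def cost_cheapest[OF I B x] by auto
qed

text \<open>The floor-price candidate is the only possible equilibrium, so existence amounts to
  positive demand in it.\<close>

lemma implementable_iff:
  "implementable I \<longleftrightarrow>
    info_structure I \<and> (\<forall>B\<in>I. 0 < share I quality floor_price B)"
proof
  assume *: "implementable I"
  then obtain p H \<beta> where I: "info_structure I" and eq: "equilibrium I p H \<beta>"
    unfolding implementable_def by blast
  have "0 < demand I \<beta> B p" if "B \<in> I" for B
    using eq that unfolding equilibrium_def by blast
  then show "info_structure I \<and> (\<forall>B\<in>I. 0 < share I quality floor_price B)"
    using I demand_equilibrium[OF I _ eq] by simp
next
  assume "info_structure I \<and> (\<forall>B\<in>I. 0 < share I quality floor_price B)"
  then show "implementable I"
    unfolding implementable_def using equilibrium_floor[of I] by blast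
qed

text \<open>All equilibria yield the same value, which justifies \<open>THE\<close>; market clearing
  makes both arguments of \<open>min\<close> equal to the demand.\<close>

lemma revenue_eq:
  assumes "implementable I"
  shows "revenue I = ereal (\<Sum>B\<in>I. floor_price B * share I quality floor_price B)"
proof -
  have I: "info_structure I" and ex: "\<exists>p H \<beta>. equilibrium I p H \<beta>"
    using assms unfolding implementable_def by auto
  have val: "revenue_at I p H \<beta> = ereal (\<Sum>B\<in>I. floor_price B * share I quality floor_price B)"
    if eq: "equilibrium I p H \<beta>" for p H \<beta>
  proof -
    have "ereal (p B) * min (ereal (demand I \<beta> B p))
          (ereal (seller_mass H B) * sales I \<beta> H B (p B) p) =
        ereal (floor_price B * share I quality floor_price B)" if B: "B \<in> I" for B
    proof -
      have "ereal (seller_mass H B) * sales I \<beta> H B (p B) p = ereal (demand I \<beta> B p)"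
        using eq B unfolding equilibrium_def by blast
      then show ?thesis
        using equilibrium_unique(1)[OF I B eq] demand_equilibrium[OF I B eq] by simp
    qed
    then have "revenue_at I p H \<beta> = (\<Sum>B\<in>I. ereal (floor_price B * share I quality floor_price B))"
      unfolding revenue_at_def by (intro sum.cong) simp_all
    then show ?thesis by simp
  qed
  show ?thesis
    unfolding revenue_def
  proof (rule the_equality)
    obtain p H \<beta> where "equilibrium I p H \<beta>" using ex by blast
    then show "\<exists>p H \<beta>. equilibrium I p H \<beta> \<and>
        ereal (\<Sum>B\<in>I. floor_price B * share I quality floor_price B) = revenue_at I p H \<beta>"
      using val[symmetric] by blast
  qed (use val in blast)
qed

section \<open>Optimality of a single member\<close>

text \<open>Different cells have different costs, and disjoint members cannot share their cheapest
  cell. This supplies the distinct prices that the revenue comparison requires.\<close>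

lemma floor_price_inj:
  assumes I: "info_structure I"
  shows "inj_on floor_price I"
proof (rule inj_onI)
  fix B C assume B: "B \<in> I" and C: "C \<in> I" and eq: "floor_price B = floor_price C"
  obtain i j where i: "i \<in> {1..l}" "cheapest B = A i" and j: "j \<in> {1..l}" "cheapest C = A j"
    using cheapest_cell[OF I] B C by metis
  obtain x y where x: "x \<in> A i" and y: "y \<in> A j" using cell_nonempty i(1) j(1) by blast
  have "c x = c y" using cost_cheapest[OF I] B C x y i j eq by metis
  then have "i = j"
    using cost_less[OF i(1) j(1) _ x y] cost_less[OF j(1) i(1) _ y x] by (metis less_irrefl nat_neq_iff)
  then have "x \<in> B \<inter> C"
    using x i j cheapest_subset[OF I B] cheapest_subset[OF I C] by auto
  then show "B = C" using I B C unfolding info_structure_def disjoint_def by blast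
qed

text \<open>Without competitors the share of \<open>B\<close> does not fall, so \<open>{B}\<close>
  is implementable and earns the single-offer revenue that bounds the revenue of
  \<open>J\<close>.\<close>

lemma single_revenue_ge:
  assumes cvx: "convex_on {a..b} (\<lambda>m. F m * m)" and J: "implementable J"
  shows "\<exists>B\<in>J. implementable {B} \<and> revenue J \<le> revenue {B}"
proof -
  have I: "info_structure J" and share: "\<And>B. B \<in> J \<Longrightarrow> 0 < share J quality floor_price B"
    using J unfolding implementable_iff by auto
  have fin: "finite J" and "J \<noteq> {}"
    using I info_structure_finite unfolding info_structure_def by auto
  then obtain B where B: "B \<in> J" and le: "(\<Sum>j\<in>J. floor_price j * share J quality floor_price j)
      \<le> floor_price B * (1 - F (floor_price B / quality B))"
    using revenue_le_top[OF cvx fin _ floor_price_inj[OF I] floor_price_pos[OF I] share] by metis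
  have "0 < share {B} quality floor_price B"
    using share[OF B] share_antimono[OF fin, of "{B}" quality floor_price B] B by simp
  then have impl: "implementable {B}"
    using info_structure_single[OF I B] unfolding implementable_iff by simp
  have "share {B} quality floor_price B = 1 - F (floor_price B / quality B)"
    using share_pos_quality[OF share[OF B] floor_price_pos[OF I B]] by (intro share_single) auto
  then have "revenue J \<le> revenue {B}"
    using le unfolding revenue_eq[OF J] revenue_eq[OF impl] by simp
  then show ?thesis using B impl by blast
qed

text \<open>Every implementable structure is dominated by an implementable singleton, and finitely
  many singletons have a maximum.\<close>

lemma single_separating_optimal:
  assumes cvx: "convex_on {a..b} (\<lambda>m. F m * m)" and ex: "\<exists>I. implementable I"
  shows "\<exists>I. separating 1 I \<and> implementable I \<and> (\<forall>J. implementable J \<longrightarrow> revenue J \<le> revenue I)"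
proof -
  define S where "S = {B. implementable {B}}"
  have "S \<subseteq> (\<lambda>S. \<Union>i\<in>S. A i) ` Pow {1..l}"
    using info_structure_subset unfolding S_def implementable_def by blast
  then have fin: "finite S" by (rule finite_subset) simp
  have "S \<noteq> {}" using ex single_revenue_ge[OF cvx] unfolding S_def by blast
  define R where "R = Max ((\<lambda>B. revenue {B}) ` S)"
  have "R \<in> (\<lambda>B. revenue {B}) ` S"
    unfolding R_def using fin \<open>S \<noteq> {}\<close> by (intro Max_in) auto
  then obtain B where B: "B \<in> S" "R = revenue {B}" by blast
  have max: "revenue {C} \<le> revenue {B}" if "C \<in> S" for C
    using that fin unfolding B(2)[symmetric] R_def by (intro Max_ge) auto
  have "revenue J \<le> revenue {B}" if J: "implementable J" for J
  proof -
    obtain C where "implementable {C}" "revenue J \<le> revenue {C}"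
      using single_revenue_ge[OF cvx J] by blast
    then show ?thesis using max[of C] unfolding S_def by auto
  qed
  moreover have "separating 1 {B}" "implementable {B}"
    using B unfolding S_def separating_def implementable_def by auto
  ultimately show ?thesis by blast
qed

end

theorem corollary3:
  fixes xbar :: real
    and \<phi> :: "real measure"
    and A :: "nat \<Rightarrow> real set"
    and l :: nat
    and c F :: "real \<Rightarrow> real"
    and a b :: real
  assumes "market xbar \<phi> A l c F a b"
    and "convex_on {a..b} (\<lambda>m. F m * m)"
    and "\<exists>I. market.implementable \<phi> A l c F a b I"
  shows "\<exists>I. market.separating A l 1 I \<and>
             market.implementable \<phi> A l c F a b I \<and>
             (\<forall>J. market.implementable \<phi> A l c F a b J \<longrightarrow>
                  market.revenue \<phi> c F a b J \<le> market.revenue \<phi> c F a b I)"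
  using market.single_separating_optimal[OF assms] .

end
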